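(* Let $\omega_{4k^2+2}\subset\mathbb{S}^2$, $k\in\mathbb{N}$, denote the equal area octahedral configuration with $4k^2+2$ points. The sequence of equal area octahedral configurations is quasi-uniform with $$\gamma(\omega_{4k^2+2})\le\frac14\sqrt{\frac{4+\pi^2}{2-(k+1)^2/k^2}}\;\longrightarrow\;\frac{\sqrt{4+\pi^2}}{4}\approx0.931048\ldots,\qquad k\to\infty,$$ where the arrow refers to the convergence of the upper bound.
   Context: $\mathbb{S}^2=\{x\in\mathbb{R}^3:|x|=1\}$ with $|\cdot|$ the Euclidean norm. Equal area octahedral configurations: let $L=\sqrt{2\pi}/\sqrt[4]{3}$ and let $\mathbb{K}=\{(X,Y,Z)\in\mathbb{R}^3:|X|+|Y|+|Z|=L/\sqrt2\}$ be the regular octahedron of edge length $L$ and surface area $4\pi$. The area preserving map $\mathcal{U}=(\mathcal{U}_x,\mathcal{U}_y,\mathcal{U}_z):\mathbb{K}\to\mathbb{S}^2$ is $$\mathcal{U}_z=\frac{2Z}{L^2}(\sqrt2L-|Z|),\quad \mathcal{U}_x=\mathrm{sgn}(X)\sqrt{1-\mathcal{U}_z^2}\cos\frac{\pi|Y|}{2(|X|+|Y|)},\quad \mathcal{U}_y=\mathrm{sgn}(Y)\sqrt{1-\mathcal{U}_z^2}\sin\frac{\pi|Y|}{2(|X|+|Y|)},$$ (with $\mathcal{U}_x=\mathcal{U}_y=0$ when $X=Y=0$). For $k\in\mathbb{N}$, each of the 8 faces of $\mathbb{K}$ is divided into $k^2$ congruent equilateral triangles of edge length $L/k$ by the regular triangular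 grid; $\omega_{4k^2+2}$ is the image under $\mathcal{U}$ of the set of all vertices of these triangles (there are $4k^2+2$ of them). On the face with nonnegative coordinates these vertices are $\bigl(\frac{iL}{k\sqrt2},\frac{jL}{k\sqrt2},\frac{L}{\sqrt2}(1-\frac{i+j}{k})\bigr)$ for integers $i,j\ge0$, $i+j\le k$. For a finite configuration $\omega\subset\mathbb{S}^2$ with at least two points, $\delta(\omega)=\min_{x\ne y\in\omega}|x-y|$ is the separation, $\eta(\omega)=\max_{y\in\mathbb{S}^2}\min_{x\in\omega}|x-y|$ is the covering radius, and $\gamma(\omega)=\eta(\omega)/\delta(\omega)$ is the mesh ratio. A sequence of configurations is quasi-uniform if its sequence of mesh ratios is bounded as the number of points tends to infinity.
   Formalization: The bound on the mesh ratio is stated for k ≥ 3 only: for k = 1 and k = 2 the quantity 2-(k+1)²/k² is negative and the square root is undefined; the value 0.931048 is read as rounded to six decimals. *)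

theory Defs
  imports "HOL-Analysis.Analysis"
begin

text \<open>Configurations on the unit sphere.\<close>

definition configuration :: "(real^3) set \<Rightarrow> bool" where
  "configuration \<omega> \<longleftrightarrow> finite \<omega> \<and> card \<omega> \<ge> 2 \<and> \<omega> \<subseteq> sphere 0 1"

definition separation :: "(real^3) set \<Rightarrow> real" where
  "separation \<omega> = Min {dist x y | x y. x \<in> \<omega> \<and> y \<in> \<omega> \<and> x \<noteq> y}"

(* The supremum is a maximum, since the sphere is compact and the minimum distance to a
   nonempty finite set is continuous. *)
definition covering_radius :: "(real^3) set \<Rightarrow> real" where
  "covering_radius \<omega> = (SUP y\<in>sphere 0 1. Min ((\<lambda>x. dist x y) ` \<omega>))"

definition mesh_ratio :: "(real^3) set \<Rightarrow> real" where
  "mesh_ratio \<omega> = covering_radius \<omega> / separation \<omega>"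

definition quasi_uniform :: "(nat \<Rightarrow> (real^3) set) \<Rightarrow> bool" where
  "quasi_uniform \<omega> \<longleftrightarrow>
     (\<forall>n. configuration (\<omega> n)) \<and>
     filterlim (\<lambda>n. card (\<omega> n)) at_top sequentially \<and>
     Bseq (\<lambda>n. mesh_ratio (\<omega> n))"

text \<open>The octahedron of surface area \<open>4 * pi\<close>; \<open>octa_L\<close> is its edge length.\<close>

definition octa_L :: real where
  "octa_L = sqrt (2 * pi) / root 4 3"

definition octahedron :: "(real^3) set" where
  "octahedron = {p. \<bar>p$1\<bar> + \<bar>p$2\<bar> + \<bar>p$3\<bar> = octa_L / sqrt 2}"

definition octa_Uz :: "real^3 \<Rightarrow> real" where
  "octa_Uz p = 2 * p$3 / octa_L\<^sup>2 * (sqrt 2 * octa_L - \<bar>p$3\<bar>)"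

(* Defined on all of space, but used on the octahedron only. Where p$1 = p$2 = 0 the quotient
   in the angle is 0 / 0 = 0, and the first two components vanish because sgn 0 = 0. *)
definition octa_U :: "real^3 \<Rightarrow> real^3" where
  "octa_U p = vector
     [sgn (p$1) * sqrt (1 - (octa_Uz p)\<^sup>2) * cos (pi * \<bar>p$2\<bar> / (2 * (\<bar>p$1\<bar> + \<bar>p$2\<bar>))),
      sgn (p$2) * sqrt (1 - (octa_Uz p)\<^sup>2) * sin (pi * \<bar>p$2\<bar> / (2 * (\<bar>p$1\<bar> + \<bar>p$2\<bar>))),
      octa_Uz p]"

text \<open>
  The vertices of the regular triangular grid that divides the triangle with corners
  \<open>a\<close>, \<open>b\<close>, \<open>c\<close> into \<open>k\<^sup>2\<close> congruent triangles, each side being cut into \<open>k\<close> equal parts.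
\<close>

definition tri_grid :: "nat \<Rightarrow> real^3 \<Rightarrow> real^3 \<Rightarrow> real^3 \<Rightarrow> (real^3) set" where
  "tri_grid k a b c =
     {a + (real i / real k) *\<^sub>R (b - a) + (real j / real k) *\<^sub>R (c - a) | i j. i + j \<le> k}"

(* A face is selected by the signs of the three coordinates. *)
definition octa_vertices :: "nat \<Rightarrow> (real^3) set" where
  "octa_vertices k =
     (\<Union>s1\<in>{-1, 1}. \<Union>s2\<in>{-1, 1}. \<Union>s3\<in>{-1, 1}.
        tri_grid k (vector [0, 0, s3 * (octa_L / sqrt 2)])
                   (vector [s1 * (octa_L / sqrt 2), 0, 0])
                   (vector [0, s2 * (octa_L / sqrt 2), 0]))"

definition octa_config :: "nat \<Rightarrow> (real^3) set" where
  "octa_config k = octa_U ` octa_vertices k"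

lemma tri_grid_octa_face:
  "tri_grid k (vector [0, 0, s3 * (octa_L / sqrt 2)])
              (vector [s1 * (octa_L / sqrt 2), 0, 0])
              (vector [0, s2 * (octa_L / sqrt 2), 0]) =
   {vector [s1 * (real i * octa_L / (real k * sqrt 2)),
            s2 * (real j * octa_L / (real k * sqrt 2)),
            s3 * (octa_L / sqrt 2 * (1 - (real i + real j) / real k))] | i j. i + j \<le> k}"
proof -
  have "vector [0, 0, s3 * (octa_L / sqrt 2)]
        + (real i / real k) *\<^sub>R
            (vector [s1 * (octa_L / sqrt 2), 0, 0] - vector [0, 0, s3 * (octa_L / sqrt 2)])
        + (real j / real k) *\<^sub>R
            (vector [0, s2 * (octa_L / sqrt 2), 0] - vector [0, 0, s3 * (octa_L / sqrt 2)])
      = (vector [s1 * (real i * octa_L / (real k * sqrt 2)),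
            s2 * (real j * octa_L / (real k * sqrt 2)),
            s3 * (octa_L / sqrt 2 * (1 - (real i + real j) / real k))] :: real^3)" for i j
    by (simp add: vec_eq_iff forall_3 algebra_simps add_divide_distrib)
  then show ?thesis
    unfolding tri_grid_def by simp
qed

lemma octa_vertices_subset_octahedron:
  assumes "k > 0"
  shows "octa_vertices k \<subseteq> octahedron"
proof -
  have pos: "octa_L / sqrt 2 > 0"
    by (simp add: octa_L_def)
  have "\<bar>real i * octa_L / (real k * sqrt 2)\<bar> + \<bar>real j * octa_L / (real k * sqrt 2)\<bar>
      + \<bar>octa_L / sqrt 2 * (1 - (real i + real j) / real k)\<bar> = octa_L / sqrt 2"
    if "i + j \<le> k" for i j
  proof -
    define h where "h = octa_L / sqrt 2"
    have h: "h > 0" using pos by (simp add: h_def)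
    have "real i + real j \<le> real k" using that by linarith
    then have "1 - (real i + real j) / real k \<ge> 0"
      using assms by simp
    then have "\<bar>h * (1 - (real i + real j) / real k)\<bar> = h * (1 - (real i + real j) / real k)"
      using h by simp
    moreover have "\<bar>real i * octa_L / (real k * sqrt 2)\<bar> = h * (real i / real k)"
      "\<bar>real j * octa_L / (real k * sqrt 2)\<bar> = h * (real j / real k)"
      using pos by (simp_all add: h_def zero_less_divide_iff mult.commute)
    ultimately show ?thesis
      unfolding h_def[symmetric] by (simp add: algebra_simps add_divide_distrib)
  qed
  then show ?thesis
    unfolding octa_vertices_def tri_grid_octa_face octahedron_def
    by (auto simp: abs_mult)
qed

end

theory Submission
  imports Defs "HOL-Real_Asymp.Real_Asymp"
begin

text \<open>
  In the closed octant, the map \<open>U\<close> sends the \<open>m\<close>-th ring of grid points (counted from the pole) to the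
  \<open>m + 1\<close> points of height \<open>1 - (m/k)\<^sup>2\<close> and azimuth \<open>\<pi>j / (2m)\<close>.

  Separation: the ring is at chordal distance \<open>\<surd>2 \<cdot> m/k\<close> from the pole, so points of different rings are
  at least \<open>\<surd>2 / k\<close> apart by the triangle inequality; within a ring this follows from
  \<open>m sin (\<pi>/(4m)) \<ge> sin (\<pi>/4)\<close>.

  Covering: a point between the rings \<open>m\<close> and \<open>m + 1\<close> is compared with the nearest point of each.
  With \<open>a\<close> the relative height, the average of the two squared distances with weights \<open>1 - a\<close> and \<open>a\<close> is at
  most \<open>(h\<^sup>2 + b\<^sup>2)/4\<close>, where \<open>h = 2/\<surd>q\<close> and \<open>b = \<pi>\<surd>q/2\<close> (times \<open>1/k\<close>, with \<open>q = 2 - (m/k)\<^sup>2\<close>) are the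
  local ring distance and point spacing. The azimuths of the two rings interlace, which is
  needed to avoid an excess of relative size \<open>1/m\<^sup>2\<close> near the pole. The bound is largest at the
  pole, up to an error absorbed by \<open>2 - (k+1)\<^sup>2/k\<^sup>2\<close>.
\<close>

subsection \<open>The configuration in polar form\<close>

text \<open>\<open>s\<close> is the chordal distance to the north pole, divided by \<open>\<surd>2\<close>.\<close>

definition octa_point :: "real \<Rightarrow> real \<Rightarrow> real^3" where
  "octa_point s \<phi> = vector [s * sqrt (2 - s\<^sup>2) * cos \<phi>, s * sqrt (2 - s\<^sup>2) * sin \<phi>, 1 - s\<^sup>2]"

text \<open>With entries \<pm>1 these are the reflections in the coordinate planes. They permute the
  faces of the octahedron and reduce both estimates to one octant.\<close>

definition flip :: "real \<Rightarrow> real \<Rightarrow> real \<Rightarrow> real^3 \<Rightarrow> real^3" where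
  "flip a b c p = vector [a * p$1, b * p$2, c * p$3]"

lemma octa_L_pos: "octa_L > 0"
  by (simp add: octa_L_def)

text \<open>With r = (i + j) / k and h = L / sqrt 2, the height |Z| = h (1 - r) and L = sqrt 2 h
  turn U_z into \<pm>(1 - r) (1 + r). Hence sqrt (1 - U_z^2) = r sqrt (2 - r^2), and the angle
  depends on j / (i + j) only. At the pole the angle is 0 / 0 = 0, but there r = 0.\<close>

lemma octa_U_grid_point:
  assumes "k > 0" "i + j \<le> k" and s: "s1 \<in> {-1, 1}" "s2 \<in> {-1, 1}" "s3 \<in> {-1, 1}"
  shows "octa_U (vector [s1 * (real i * octa_L / (real k * sqrt 2)),
            s2 * (real j * octa_L / (real k * sqrt 2)),
            s3 * (octa_L / sqrt 2 * (1 - (real i + real j) / real k))])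
    = flip s1 s2 s3 (octa_point (real (i + j) / real k) (pi * real j / (2 * real (i + j))))"
    (is "octa_U ?p = _")
proof -
  define r where "r = real (i + j) / real k"
  define h where "h = octa_L / sqrt 2"
  have h: "h > 0" using octa_L_pos by (simp add: h_def)
  have hL: "octa_L = sqrt 2 * h" by (simp add: h_def)
  have r: "0 \<le> r" "r \<le> 1" using assms by (auto simp: r_def simp flip: of_nat_add)
  define p :: "real^3" where "p = ?p"
  have p1: "p $ 1 = s1 * (h * (real i / real k))"
    and p2: "p $ 2 = s2 * (h * (real j / real k))"
    and p3: "p $ 3 = s3 * (h * (1 - r))"
    by (simp_all add: p_def h_def r_def mult_ac)
  have a3: "\<bar>p $ 3\<bar> = h * (1 - r)"
    unfolding p3 using s h r by (auto simp: abs_mult)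
  have a1: "\<bar>p $ 1\<bar> = h * (real i / real k)" and a2: "\<bar>p $ 2\<bar> = h * (real j / real k)"
    unfolding p1 p2 using s h by (auto simp: abs_mult)
  have z: "octa_Uz p = s3 * (1 - r\<^sup>2)"
  proof -
    have "octa_Uz p = 2 * (s3 * (h * (1 - r))) / (2 * h\<^sup>2) * (2 * h - h * (1 - r))"
      unfolding octa_Uz_def a3 unfolding p3 hL
      by (simp add: power_mult_distrib flip: mult.assoc)
    also have "\<dots> = s3 * (1 - r\<^sup>2)"
      using h by (simp add: field_simps power2_eq_square)
    finally show ?thesis .
  qed
  have "r\<^sup>2 * (2 - r\<^sup>2) = 1 - (octa_Uz p)\<^sup>2"
    unfolding z using s(3) by (auto simp: power2_eq_square algebra_simps)
  then have rho: "sqrt (1 - (octa_Uz p)\<^sup>2) = r * sqrt (2 - r\<^sup>2)"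
    using r by (metis real_sqrt_mult real_sqrt_abs abs_of_nonneg)
  have ang: "pi * \<bar>p $ 2\<bar> / (2 * (\<bar>p $ 1\<bar> + \<bar>p $ 2\<bar>)) = pi * real j / (2 * real (i + j))"
  proof -
    have "pi * \<bar>p $ 2\<bar> / (2 * (\<bar>p $ 1\<bar> + \<bar>p $ 2\<bar>))
        = ((h / real k) * (pi * real j)) / ((h / real k) * (2 * real (i + j)))"
      unfolding a1 a2 by (simp add: algebra_simps)
    also have "\<dots> = pi * real j / (2 * real (i + j))"
      using h \<open>k > 0\<close> by (subst mult_divide_mult_cancel_left) auto
    finally show ?thesis .
  qed
  have g1: "sgn (p $ 1) = (if i = 0 then 0 else s1)" and g2: "sgn (p $ 2) = (if j = 0 then 0 else s2)"
    unfolding p1 p2 using s h \<open>k > 0\<close> by (auto simp: sgn_mult)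
  \<comment> \<open>For i = 0 the map returns 0 because of \<open>sgn\<close>. The polar form
    agrees: the angle is \<pi>/2, or r = 0 if also j = 0.\<close>
  have c: "r * sqrt (2 - r\<^sup>2) * cos (pi * real j / (2 * real (i + j))) = 0" if "i = 0"
    using that by (cases "j = 0") (auto simp: r_def)
  have "octa_U p = flip s1 s2 s3 (octa_point r (pi * real j / (2 * real (i + j))))"
    unfolding octa_U_def ang rho g1 g2 flip_def octa_point_def vector_3 unfolding z
    using c by (auto simp: vec_eq_iff forall_3)
  then show ?thesis unfolding p_def r_def .
qed

text \<open>Substitution m = i + j: m is the ring and j the position on it. The indexing is
  redundant, since points on coordinate planes arise from several sign choices.\<close>

lemma octa_config_eq:
  assumes "k > 0"
  shows "octa_config k = {flip s1 s2 s3 (octa_point (real m / real k) (pi * real j / (2 * real m))) |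
    s1 s2 s3 m j. s1 \<in> {-1, 1} \<and> s2 \<in> {-1, 1} \<and> s3 \<in> {-1, 1} \<and> j \<le> m \<and> m \<le> k}"
    (is "_ = ?R")
proof
  show "octa_config k \<subseteq> ?R"
  proof
    fix x assume "x \<in> octa_config k"
    then obtain s1 s2 s3 i j where s: "s1 \<in> {-1, 1}" "s2 \<in> {-1, 1}" "s3 \<in> {-1, 1}" and ij: "i + j \<le> k"
      and x: "x = octa_U (vector [s1 * (real i * octa_L / (real k * sqrt 2)),
            s2 * (real j * octa_L / (real k * sqrt 2)),
            s3 * (octa_L / sqrt 2 * (1 - (real i + real j) / real k))])"
      unfolding octa_config_def octa_vertices_def tri_grid_octa_face by blast
    have "x = flip s1 s2 s3 (octa_point (real (i + j) / real k) (pi * real j / (2 * real (i + j))))"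
      unfolding x by (rule octa_U_grid_point[OF assms ij s])
    then show "x \<in> ?R" using s ij le_add2 by blast
  qed
next
  show "?R \<subseteq> octa_config k"
  proof
    fix x assume "x \<in> ?R"
    then obtain s1 s2 s3 m j where s: "s1 \<in> {-1, 1}" "s2 \<in> {-1, 1}" "s3 \<in> {-1, 1}"
      and mj: "j \<le> m" "m \<le> k"
      and x: "x = flip s1 s2 s3 (octa_point (real m / real k) (pi * real j / (2 * real m)))"
      by blast
    have ij: "(m - j) + j \<le> k" and e: "m - j + j = m" using mj by auto
    have "x = octa_U (vector [s1 * (real (m - j) * octa_L / (real k * sqrt 2)),
            s2 * (real j * octa_L / (real k * sqrt 2)),
            s3 * (octa_L / sqrt 2 * (1 - (real (m - j) + real j) / real k))])"
      unfolding octa_U_grid_point[OF assms ij s] unfolding e x ..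
    then show "x \<in> octa_config k"
      unfolding octa_config_def octa_vertices_def tri_grid_octa_face using s ij by blast
  qed
qed

section \<open>Chordal distances in polar form and invariance under reflections\<close>

lemma dist_vec3_sq:
  fixes x y :: "real^3"
  shows "(dist x y)\<^sup>2 = (x$1 - y$1)\<^sup>2 + (x$2 - y$2)\<^sup>2 + (x$3 - y$3)\<^sup>2"
  by (simp add: dist_vec_def L2_set_def sum_3 dist_real_def)

text \<open>For s, t \<ge> 0 and polar angles \<alpha>, \<beta> one has s = sqrt 2 sin (\<alpha>/2)
  and sqrt (2 - s^2) = sqrt 2 cos (\<alpha>/2), likewise for t and \<beta>. So the first summand is
  the squared chord 4 sin^2 ((\<alpha> - \<beta>)/2) at equal azimuth, and the second is the
  azimuthal part.\<close>

lemma dist_octa_point_sq: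
  assumes "s\<^sup>2 \<le> 2" "t\<^sup>2 \<le> 2"
  shows "(dist (octa_point s \<phi>) (octa_point t \<psi>))\<^sup>2 =
    (s * sqrt (2 - t\<^sup>2) - t * sqrt (2 - s\<^sup>2))\<^sup>2
    + 2 * (s * sqrt (2 - s\<^sup>2)) * (t * sqrt (2 - t\<^sup>2)) * (1 - cos (\<phi> - \<psi>))"
proof -
  define p where "p = sqrt (2 - s\<^sup>2)"
  define q where "q = sqrt (2 - t\<^sup>2)"
  have p: "p * p = 2 - s * s" and q: "q * q = 2 - t * t"
    using assms by (auto simp: p_def q_def power2_eq_square)
  have cs: "cos \<phi> * cos \<phi> = 1 - sin \<phi> * sin \<phi>" "cos \<psi> * cos \<psi> = 1 - sin \<psi> * sin \<psi>"
    by (simp_all add: cos_squared_eq flip: power2_eq_square)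
  show ?thesis
    unfolding dist_vec3_sq octa_point_def vector_3 cos_diff
    unfolding power2_eq_square[of s] power2_eq_square[of t]
    using p q cs unfolding p_def[symmetric, unfolded power2_eq_square] q_def[symmetric, unfolded power2_eq_square]
    unfolding power2_eq_square by algebra
qed

lemma octa_point_in_sphere:
  assumes "s\<^sup>2 \<le> 2" shows "norm (octa_point s \<phi>) = 1"
proof -
  have "(norm (octa_point s \<phi>))\<^sup>2 = s\<^sup>2 * (2 - s\<^sup>2) * ((cos \<phi>)\<^sup>2 + (sin \<phi>)\<^sup>2) + (1 - s\<^sup>2)\<^sup>2"
    using dist_vec3_sq[of "octa_point s \<phi>" 0] assms
    by (simp add: octa_point_def power_mult_distrib algebra_simps del: sin_cos_squared_add2)
  also have "\<dots> = 1" by (simp add: power2_eq_square algebra_simps)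
  finally show ?thesis by (simp add: power2_eq_1_iff) (metis norm_ge_zero le_minus_one_simps(3))
qed

lemma norm_flip:
  assumes "a \<in> {-1, 1}" "b \<in> {-1, 1}" "c \<in> {-1, 1}"
  shows "norm (flip a b c p) = norm p"
  using assms by (auto simp: norm_vec_def L2_set_def sum_3 flip_def)

lemma dist_flip:
  assumes "a \<in> {-1, 1}" "b \<in> {-1, 1}" "c \<in> {-1, 1}"
  shows "dist (flip a b c p) (flip a b c q) = dist p q"
proof -
  have "flip a b c p - flip a b c q = flip a b c (p - q)"
    by (simp add: flip_def vec_eq_iff forall_3 algebra_simps)
  then show ?thesis by (simp add: dist_norm norm_flip[OF assms])
qed

section \<open>Size of the configurations\<close>

lemma finite_octa_config: "k > 0 \<Longrightarrow> finite (octa_config k)"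
proof -
  assume k: "k > 0"
  have "octa_config k \<subseteq> (\<lambda>(s1, s2, s3, m, j). flip s1 s2 s3 (octa_point (real m / real k) (pi * real j / (2 * real m))))
     ` ({-1, 1} \<times> {-1, 1} \<times> {-1, 1} \<times> {..k} \<times> {..k})"
    (is "_ \<subseteq> ?f ` ?A")
  proof
    fix x assume "x \<in> octa_config k"
    then obtain s1 s2 s3 m j where s: "s1 \<in> {-1, 1}" "s2 \<in> {-1, 1}" "s3 \<in> {-1, 1}"
      and j: "j \<le> m" "m \<le> k"
      and x: "x = flip s1 s2 s3 (octa_point (real m / real k) (pi * real j / (2 * real m)))"
      unfolding octa_config_eq[OF k] by blast
    have "x = ?f (s1, s2, s3, m, j)" using x by simp
    moreover have "(s1, s2, s3, m, j) \<in> ?A" using s j by simp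
    ultimately show "x \<in> ?f ` ?A" by (rule image_eqI)
  qed
  then show ?thesis by (rule finite_subset) simp
qed

text \<open>The points with j = 0 on the rings 0, ..., k have distinct heights. This crude count
  already gives two points and divergence of the cardinality.\<close>

lemma card_octa_config: "k > 0 \<Longrightarrow> k < card (octa_config k)"
proof -
  assume k: "k > 0"
  let ?f = "\<lambda>m. flip 1 1 1 (octa_point (real m / real k) (pi * real 0 / (2 * real m)))"
  have "inj_on ?f {..k}"
  proof (rule inj_onI)
    fix m n assume "?f m = ?f n"
    then have "?f m $ 3 = ?f n $ 3" by simp
    then show "m = n" using k
      by (auto simp: flip_def octa_point_def power_divide power2_eq_iff)
  qed
  then have "card (?f ` {..k}) = Suc k" by (simp add: card_image)
  moreover have "?f ` {..k} \<subseteq> octa_config k"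
    unfolding octa_config_eq[OF k] by blast
  ultimately show ?thesis
    using card_mono[OF finite_octa_config[OF k], of "?f ` {..k}"] by linarith
qed

lemma configuration_octa_config:
  assumes k: "k > 0" shows "configuration (octa_config k)"
proof -
  have "norm x = 1" if x: "x \<in> octa_config k" for x
  proof -
    obtain s1 s2 s3 m j where s: "s1 \<in> {-1, 1}" "s2 \<in> {-1, 1}" "s3 \<in> {-1, 1}" and m: "m \<le> k"
      and x: "x = flip s1 s2 s3 (octa_point (real m / real k) (pi * real j / (2 * real m)))"
      using x unfolding octa_config_eq[OF k] by blast
    have "(real m / real k)\<^sup>2 \<le> 1" using m k by (intro power_le_one) auto
    then show ?thesis unfolding x norm_flip[OF s] by (intro octa_point_in_sphere) simp
  qed
  then show ?thesis
    unfolding configuration_def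
    using finite_octa_config[OF k] card_octa_config[OF k] k by auto
qed

subsection \<open>Covering radius\<close>

lemma one_minus_cos_le: "1 - cos x \<le> x\<^sup>2 / 2" for x :: real
proof -
  have "\<bar>sin (x / 2)\<bar> \<le> \<bar>x / 2\<bar>" by (rule abs_sin_x_le_abs_x)
  then have "(sin (x / 2))\<^sup>2 \<le> (x / 2)\<^sup>2" by (rule abs_le_square_iff[THEN iffD1])
  then show ?thesis using cos_double_sin[of "x / 2"] by (simp add: power_divide)
qed

text \<open>Here l and u bound a strip containing both points. The meridional chord times its
  conjugate s q + t p equals 2 (s - t) (s + t), and the conjugate is at least (s + t) w; this gives
  the chord bound 2 |s - t| / w. The azimuthal part uses 1 - cos x \<le> x^2 / 2 and p q \<le> 2 -
  l^2.\<close>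

lemma dist_octa_point_le:
  assumes l: "0 \<le> l" "l \<le> s" "l \<le> t" and u: "s \<le> u" "t \<le> u" "u \<le> 1"
  shows "(dist (octa_point s \<phi>) (octa_point t \<psi>))\<^sup>2
    \<le> 4 * (s - t)\<^sup>2 / (2 - u\<^sup>2) + s * t * (2 - l\<^sup>2) * (\<phi> - \<psi>)\<^sup>2"
proof -
  define p where "p = sqrt (2 - s\<^sup>2)"
  define q where "q = sqrt (2 - t\<^sup>2)"
  define w where "w = sqrt (2 - u\<^sup>2)"
  have u2: "u\<^sup>2 \<le> 1" using l u by (intro power_le_one) auto
  have su: "s\<^sup>2 \<le> u\<^sup>2" "t\<^sup>2 \<le> u\<^sup>2" and sl: "l\<^sup>2 \<le> s\<^sup>2" "l\<^sup>2 \<le> t\<^sup>2"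
    using l u by (auto intro: power_mono)
  have w: "0 < w" "w \<le> p" "w \<le> q" "w\<^sup>2 = 2 - u\<^sup>2"
    using u2 su by (auto simp: w_def p_def q_def)
  have p2: "p\<^sup>2 = 2 - s\<^sup>2" and q2: "q\<^sup>2 = 2 - t\<^sup>2" using u2 su by (auto simp: p_def q_def)
  have pq: "p * q \<le> 2 - l\<^sup>2"
  proof -
    have l2: "l\<^sup>2 \<le> 2" using u2 su sl by linarith
    have "p \<le> sqrt (2 - l\<^sup>2)" "q \<le> sqrt (2 - l\<^sup>2)" using sl by (auto simp: p_def q_def)
    then have "p * q \<le> sqrt (2 - l\<^sup>2) * sqrt (2 - l\<^sup>2)" using w l2 by (intro mult_mono) auto
    then show ?thesis using l2 by simp
  qed
  have "\<bar>s * q - t * p\<bar> * w \<le> 2 * \<bar>s - t\<bar>"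
  proof (cases "s + t = 0")
    case True
    then have "s = 0" "t = 0" using l by auto
    then show ?thesis by simp
  next
    case False
    then have st: "s + t > 0" using l by auto
    have "(s + t) * w \<le> s * q + t * p"
      using mult_left_mono[OF w(3), of s] mult_left_mono[OF w(2), of t] l
      by (simp add: algebra_simps)
    then have "\<bar>s * q - t * p\<bar> * ((s + t) * w) \<le> \<bar>s * q - t * p\<bar> * (s * q + t * p)"
      by (intro mult_left_mono) auto
    also have "\<dots> = \<bar>(s * q - t * p) * (s * q + t * p)\<bar>"
      using w l by (simp add: abs_mult)
    also have "(s * q - t * p) * (s * q + t * p) = 2 * (s - t) * (s + t)"
      using p2 q2 by algebra
    also have "\<bar>2 * (s - t) * (s + t)\<bar> = 2 * \<bar>s - t\<bar> * (s + t)"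
      unfolding abs_mult using st by simp
    finally have "(\<bar>s * q - t * p\<bar> * w) * (s + t) \<le> (2 * \<bar>s - t\<bar>) * (s + t)"
      by (simp add: mult_ac)
    then show ?thesis using st by simp
  qed
  then have "\<bar>(s * q - t * p) * w\<bar> \<le> \<bar>2 * (s - t)\<bar>"
    unfolding abs_mult using w by simp
  then have "((s * q - t * p) * w)\<^sup>2 \<le> (2 * (s - t))\<^sup>2" by (rule abs_le_square_iff[THEN iffD1])
  then have "(s * q - t * p)\<^sup>2 * w\<^sup>2 \<le> 4 * (s - t)\<^sup>2"
    unfolding power_mult_distrib by simp
  then have A: "(s * q - t * p)\<^sup>2 \<le> 4 * (s - t)\<^sup>2 / (2 - u\<^sup>2)"
    unfolding w(4)[symmetric] using w(1) by (simp add: pos_le_divide_eq)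
  have "2 * (s * p) * (t * q) * (1 - cos (\<phi> - \<psi>)) \<le> 2 * (s * p) * (t * q) * ((\<phi> - \<psi>)\<^sup>2 / 2)"
    using l w by (intro mult_left_mono one_minus_cos_le) auto
  also have "\<dots> = (s * t * (\<phi> - \<psi>)\<^sup>2) * (p * q)" by simp
  also have "\<dots> \<le> (s * t * (\<phi> - \<psi>)\<^sup>2) * (2 - l\<^sup>2)"
    using l by (intro mult_left_mono pq) auto
  finally have B: "2 * (s * p) * (t * q) * (1 - cos (\<phi> - \<psi>)) \<le> s * t * (2 - l\<^sup>2) * (\<phi> - \<psi>)\<^sup>2"
    by (simp add: mult_ac)
  have "s\<^sup>2 \<le> 2" "t\<^sup>2 \<le> 2" using su u2 by auto
  from dist_octa_point_sq[OF this, of \<phi> \<psi>] A B show ?thesis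
    unfolding p_def q_def by linarith
qed

section \<open>Azimuths of two consecutive rings\<close>

lemma nearer_endpoint:
  fixes a b w :: real
  assumes "a \<le> w" "w \<le> b"
  obtains "\<bar>w - a\<bar> \<le> (b - a) / 2" "\<bar>w - a\<bar> \<le> w - a" "\<bar>w - a\<bar> \<le> b - w"
  | "\<bar>w - b\<bar> \<le> (b - a) / 2" "\<bar>w - b\<bar> \<le> w - a" "\<bar>w - b\<bar> \<le> b - w"
  using assms by (cases "w - a \<le> b - w") auto

lemma nearest_fraction:
  fixes n i :: nat and w :: real
  assumes "n > 0" "i < n" "real i / real n \<le> w" "w \<le> (real i + 1) / real n"
  obtains j where "j \<le> n" "\<bar>w - real j / real n\<bar> \<le> 1 / (2 * real n)"
    "\<bar>w - real j / real n\<bar> \<le> w - real i / real n" "\<bar>w - real j / real n\<bar> \<le> (real i + 1) / real n - w"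
proof -
  have e: "((real i + 1) / real n - real i / real n) / 2 = 1 / (2 * real n)"
    using assms by (simp add: field_simps)
  show ?thesis
    by (rule nearer_endpoint[OF assms(3,4), unfolded e])
      (use that[of i] that[of "Suc i"] assms(2) in \<open>auto simp: add.commute\<close>)
qed

text \<open>The point (i + 1) / (m + 1) lies in the cell from i / m to (i + 1) / m. Left of it, the
  distances are at most w - i / m and (i + 1) / (m + 1) - w; right of it, at most (i + 1) / m - w
  and w - (i + 1) / (m + 1). In each case w cancels in the sum. The joint bound is stronger than
  adding the two single ones.\<close>

lemma interlacing_fractions:
  fixes m :: nat and w :: real
  assumes m: "m > 0" and w: "0 \<le> w" "w \<le> 1"
  obtains i j where "i \<le> m" "j \<le> Suc m"
    "\<bar>w - real i / real m\<bar> \<le> 1 / (2 * real m)"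
    "\<bar>w - real j / (real m + 1)\<bar> \<le> 1 / (2 * (real m + 1))"
    "\<bar>w - real i / real m\<bar> + \<bar>w - real j / (real m + 1)\<bar> \<le> 1 / (real m + 1)"
proof -
  \<comment> \<open>The cell containing w; the end point w = 1 is assigned to the last cell to keep
    i < m.\<close>
  obtain i where i: "i < m" "real i \<le> real m * w" "real m * w \<le> real i + 1"
  proof (cases "w = 1")
    case True
    then show ?thesis using that[of "m - 1"] m by (simp add: of_nat_diff)
  next
    case False
    then have "real m * w < real m" using m w by simp
    then have "nat \<lfloor>real m * w\<rfloor> < m" using w by (simp add: floor_less_iff nat_less_iff)
    moreover have "real (nat \<lfloor>real m * w\<rfloor>) \<le> real m * w" using w m by simp
    moreover have "real m * w \<le> real (nat \<lfloor>real m * w\<rfloor>) + 1" using w m by linarith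
    ultimately show ?thesis using that by blast
  qed
  have iw: "real i / real m \<le> w" "w \<le> (real i + 1) / real m"
    using i m by (simp_all add: field_simps)
  obtain i' where i': "i' \<le> m" "\<bar>w - real i' / real m\<bar> \<le> 1 / (2 * real m)"
    "\<bar>w - real i' / real m\<bar> \<le> w - real i / real m"
    "\<bar>w - real i' / real m\<bar> \<le> (real i + 1) / real m - w"
    by (rule nearest_fraction[OF m i(1) iw])
  have im: "real i + 1 \<le> real m" using i(1) by linarith
  show ?thesis
  proof (cases "w \<le> (real i + 1) / (real m + 1)")
    case True
    have le: "real i / real (Suc m) \<le> real i / real m" using m by (intro divide_left_mono) auto
    have "real i / real (Suc m) \<le> w" using le iw by linarith
    from nearest_fraction[OF _ _ this, of] i True obtain j where j: "j \<le> Suc m"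
      "\<bar>w - real j / real (Suc m)\<bar> \<le> 1 / (2 * real (Suc m))"
      "\<bar>w - real j / real (Suc m)\<bar> \<le> (real i + 1) / real (Suc m) - w"
      by (auto simp: add.commute)
    have "(real i + 1) / (real m + 1) - real i / real m \<le> 1 / (real m + 1)"
      using le by (simp add: add_divide_distrib add.commute)
    then show ?thesis using that[of i' j] i' j by (simp add: add.commute)
  next
    case False
    have "(real i + 1) / real m \<le> (real (Suc i) + 1) / real (Suc m)"
      using im m by (simp add: field_simps)
    then have a: "w \<le> (real (Suc i) + 1) / real (Suc m)" using iw by linarith
    have b: "real (Suc i) / real (Suc m) \<le> w" using False by (simp add: add.commute)
    from nearest_fraction[OF _ _ b a] i obtain j where j: "j \<le> Suc m"
      "\<bar>w - real j / real (Suc m)\<bar> \<le> 1 / (2 * real (Suc m))"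
      "\<bar>w - real j / real (Suc m)\<bar> \<le> w - real (Suc i) / real (Suc m)"
      by auto
    have "(real i + 1) / real m - (real i + 1) / (real m + 1) \<le> 1 / (real m + 1)"
    proof -
      have "(real i + 1) / real m - (real i + 1) / (real m + 1) = (real i + 1) / real m / (real m + 1)"
        using m by (simp add: field_simps)
      also have "\<dots> \<le> 1 / (real m + 1)" using m im by (intro divide_right_mono) auto
      finally show ?thesis .
    qed
    then show ?thesis using that[of i' j] i' j by (simp add: add.commute)
  qed
qed

lemma weighted_gap_bound:
  fixes m a b c :: real
  assumes m: "m \<ge> 1" and a: "0 \<le> a" "a \<le> 1" and b: "0 \<le> b" "b \<le> 1 / (2 * m)"
    and c: "0 \<le> c" "c \<le> 1 / (2 * (m + 1))" "b + c \<le> 1 / (m + 1)"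
  shows "(m + a) * ((1 - a) * (m * b\<^sup>2) + a * ((m + 1) * c\<^sup>2)) \<le> 1 / 4"
proof -
  txt \<open>In units of \<open>1 / (2 * (m + 1))\<close>, the two distances are at most \<open>1 + \<tau>\<close> and \<open>1 - \<tau>\<close> with
    \<open>0 \<le> \<tau> \<le> 1 / m\<close>; the claim is convex in \<open>\<tau>\<close>, so the end points \<open>X0\<close> and \<open>X1\<close> suffice.\<close>
  define \<tau> where "\<tau> = max 0 (2 * (m + 1) * b - 1)"
  have \<tau>0: "0 \<le> \<tau>" by (simp add: \<tau>_def)
  have "2 * m * b \<le> 1" using b m by (simp add: field_simps)
  then have "(2 * m * b) * (m + 1) \<le> 1 * (m + 1)" using m by (intro mult_right_mono) auto
  then have "m * (2 * (m + 1) * b - 1) \<le> 1" by (simp add: algebra_simps)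
  then have \<tau>1: "m * \<tau> \<le> 1" using m by (auto simp: \<tau>_def max_def)
  have B: "2 * (m + 1) * b \<le> 1 + \<tau>" by (simp add: \<tau>_def)
  have "2 * (m + 1) * c \<le> 1" "2 * (m + 1) * b + 2 * (m + 1) * c \<le> 2"
    using c m by (simp_all add: field_simps)
  then have C: "2 * (m + 1) * c \<le> 1 - \<tau>" by (auto simp: \<tau>_def)
  \<comment> \<open>K is the coefficient of \<tau> after \<tau>^2 is replaced by its chord \<tau> /
    m on the interval from 0 to 1 / m; \<theta> is the relative position of \<tau> in that
    interval.\<close>
  define K where "K = 2 * m\<^sup>2 + m - a * (4 * m\<^sup>2 + 2 * m - 1)"
  define \<theta> where "\<theta> = m * \<tau>"
  have \<theta>: "0 \<le> \<theta>" "\<theta> \<le> 1" using \<tau>0 \<tau>1 m by (auto simp: \<theta>_def)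
  have "\<tau> \<le> m * \<tau>" using m \<tau>0 mult_right_mono[of 1 m \<tau>] by simp
  then have \<tau>le: "\<tau> \<le> 1" using \<tau>1 by linarith
  have mt: "m * \<tau>\<^sup>2 \<le> \<tau>"
    using mult_right_mono[OF \<tau>1 \<tau>0] by (simp add: power2_eq_square mult_ac)
  have "(2 * (m + 1) * b)\<^sup>2 \<le> (1 + \<tau>)\<^sup>2" using B b m by (intro power_mono) auto
  then have "m * (2 * (m + 1) * b)\<^sup>2 \<le> m * (1 + \<tau>)\<^sup>2" using m by (intro mult_left_mono) auto
  also have "\<dots> \<le> m + 2 * m * \<tau> + \<tau>" using mt by (simp add: power2_eq_square algebra_simps)
  finally have B2: "m * (2 * (m + 1) * b)\<^sup>2 \<le> m + 2 * m * \<tau> + \<tau>" .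
  have "(2 * (m + 1) * c)\<^sup>2 \<le> (1 - \<tau>)\<^sup>2" using C c m by (intro power_mono) auto
  then have "m * (2 * (m + 1) * c)\<^sup>2 \<le> m * (1 - \<tau>)\<^sup>2" using m by (intro mult_left_mono) auto
  also have "\<dots> \<le> m - 2 * m * \<tau> + \<tau>" using mt by (simp add: power2_eq_square algebra_simps)
  finally have C2: "m * (2 * (m + 1) * c)\<^sup>2 \<le> m - 2 * m * \<tau> + \<tau>" .
  have "((1 - a) * m) * (m * (2 * (m + 1) * b)\<^sup>2) + (a * (m + 1)) * (m * (2 * (m + 1) * c)\<^sup>2)
      \<le> ((1 - a) * m) * (m + 2 * m * \<tau> + \<tau>) + (a * (m + 1)) * (m - 2 * m * \<tau> + \<tau>)"
    using a m by (intro add_mono mult_left_mono B2 C2) auto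
  also have "\<dots> = m * (m + a) + \<tau> * K"
    unfolding K_def by algebra
  finally have D: "((1 - a) * m) * (m * (2 * (m + 1) * b)\<^sup>2) + (a * (m + 1)) * (m * (2 * (m + 1) * c)\<^sup>2)
      \<le> m * (m + a) + \<tau> * K" .
  have "(m + a)\<^sup>2 \<le> (m + 1)\<^sup>2" using m a by (intro power_mono) auto
  then have X0: "m\<^sup>2 * (m + a)\<^sup>2 \<le> m\<^sup>2 * (m + 1)\<^sup>2" by (intro mult_left_mono) auto
  \<comment> \<open>The defect is m + 1 times a sum that is nonnegative for m \<ge> 1 and vanishes
    at a = 0. There b = 1 / (2 m) attains the value 1/4, so the constant is sharp.\<close>
  have X1: "(m + a) * (m\<^sup>2 * (m + a) + K) \<le> m\<^sup>2 * (m + 1)\<^sup>2"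
  proof -
    have "(m + a) * (m\<^sup>2 * (m + a) + K)
        = m\<^sup>2 * (m + 1)\<^sup>2 - (m + 1) * (2 * a * m * (m - 1) + a\<^sup>2 * (3 * m - 1))"
      unfolding K_def by algebra
    moreover have "0 \<le> (m + 1) * (2 * a * m * (m - 1) + a\<^sup>2 * (3 * m - 1))"
      using m a by (intro mult_nonneg_nonneg add_nonneg_nonneg) auto
    ultimately show ?thesis by linarith
  qed
  have "(4 * m\<^sup>2 * (m + 1)\<^sup>2) * ((m + a) * ((1 - a) * (m * b\<^sup>2) + a * ((m + 1) * c\<^sup>2)))
      = (m * (m + a)) * (((1 - a) * m) * (m * (2 * (m + 1) * b)\<^sup>2) + (a * (m + 1)) * (m * (2 * (m + 1) * c)\<^sup>2))"
    by algebra
  also have "\<dots> \<le> (m * (m + a)) * (m * (m + a) + \<tau> * K)"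
    using m a by (intro mult_left_mono D) auto
  also have "\<dots> = (1 - \<theta>) * (m\<^sup>2 * (m + a)\<^sup>2) + \<theta> * ((m + a) * (m\<^sup>2 * (m + a) + K))"
    unfolding \<theta>_def by algebra
  also have "\<dots> \<le> (1 - \<theta>) * (m\<^sup>2 * (m + 1)\<^sup>2) + \<theta> * (m\<^sup>2 * (m + 1)\<^sup>2)"
    using \<theta> by (intro add_mono mult_left_mono X0 X1) auto
  also have "\<dots> = (4 * m\<^sup>2 * (m + 1)\<^sup>2) * (1 / 4)" by (simp add: algebra_simps)
  finally show ?thesis using m by (subst (asm) mult_le_cancel_left_pos) auto
qed

lemma weighted_average_le:
  fixes a x y c :: real
  assumes "0 \<le> a" "a \<le> 1" "(1 - a) * x + a * y \<le> c"
  shows "x \<le> c \<or> y \<le> c"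
proof (rule ccontr)
  assume "\<not> ?thesis"
  then have "c < x" "c < y" by auto
  then have "min x y > c" by simp
  moreover have "(1 - a) * min x y + a * min x y \<le> (1 - a) * x + a * y"
    using assms by (intro add_mono mult_left_mono) auto
  moreover have "(1 - a) * min x y + a * min x y = min x y" by (simp add: left_diff_distrib)
  ultimately show False using assms(3) by linarith
qed

lemma ring_pair_covers:
  assumes k: "k > 0" and m: "m < k" and s: "real m / real k \<le> s" "s \<le> (real m + 1) / real k"
    and w: "0 \<le> w" "w \<le> 1"
  defines "B \<equiv> (1 / (2 - ((real m + 1) / real k)\<^sup>2) + pi\<^sup>2 / 16 * (2 - (real m / real k)\<^sup>2)) / (real k)\<^sup>2"
  obtains n j where "j \<le> n" "n \<le> k"
    "(dist (octa_point s (pi / 2 * w)) (octa_point (real n / real k) (pi * real j / (2 * real n))))\<^sup>2 \<le> B"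
proof -
  define a where "a = real k * s - real m"
  have a: "0 \<le> a" "a \<le> 1" using s k by (auto simp: a_def field_simps)
  have sa: "s = (real m + a) / real k" using k by (simp add: a_def)
  \<comment> \<open>H and G are h^2 and b^2 with q taken where it is worst on the strip: at the
    outer ring for H, at the inner ring for G.\<close>
  define H where "H = 4 / (2 - ((real m + 1) / real k)\<^sup>2)"
  define G where "G = pi\<^sup>2 / 4 * (2 - (real m / real k)\<^sup>2)"
  define d where "d n j = (dist (octa_point s (pi / 2 * w))
    (octa_point (real n / real k) (pi * real j / (2 * real n))))\<^sup>2" for n j :: nat
  have mk: "real m + 1 \<le> real k" using m by linarith
  have u1: "(real m + 1) / real k \<le> 1" using mk k by simp
  have "((real m + 1) / real k)\<^sup>2 \<le> 1" using u1 by (intro power_le_one) auto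
  then have H0: "H \<ge> 0" by (simp add: H_def)
  have "(real m / real k)\<^sup>2 \<le> 1" using mk k by (intro power_le_one) auto
  then have G0: "G \<ge> 0" by (simp add: G_def)
  have d: "(real k)\<^sup>2 * d n j \<le> H * (a - (real n - real m))\<^sup>2
      + G * ((real m + a) * (real n * (w - real j / real n)\<^sup>2))"
    if n: "m \<le> n" "n \<le> Suc m" for n j
  proof -
    have nk: "real m / real k \<le> real n / real k" "real n / real k \<le> (real m + 1) / real k"
      using n k by (auto intro!: divide_right_mono)
    have e1: "s - real n / real k = (a - (real n - real m)) / real k"
      unfolding sa using k by (simp add: field_simps)
    have e2: "pi / 2 * w - pi * real j / (2 * real n) = pi / 2 * (w - real j / real n)"
      by (simp add: algebra_simps)
    have "d n j \<le> 4 * (s - real n / real k)\<^sup>2 / (2 - ((real m + 1) / real k)\<^sup>2)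
       + s * (real n / real k) * (2 - (real m / real k)\<^sup>2)
         * (pi / 2 * w - pi * real j / (2 * real n))\<^sup>2"
      unfolding d_def by (rule dist_octa_point_le[OF _ s(1) nk(1) s(2) nk(2) u1]) simp
    also have "4 * (s - real n / real k)\<^sup>2 / (2 - ((real m + 1) / real k)\<^sup>2)
        = H * (a - (real n - real m))\<^sup>2 / (real k)\<^sup>2"
      unfolding e1 H_def by (simp add: power_divide)
    also have "s * (real n / real k) * (2 - (real m / real k)\<^sup>2)
         * (pi / 2 * w - pi * real j / (2 * real n))\<^sup>2
        = G * ((real m + a) * (real n * (w - real j / real n)\<^sup>2)) / (real k)\<^sup>2"
      unfolding e2 G_def sa by (simp add: power_mult_distrib power_divide power2_eq_square[of "real k"] mult_ac)
    finally have "d n j \<le> (H * (a - (real n - real m))\<^sup>2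
      + G * ((real m + a) * (real n * (w - real j / real n)\<^sup>2))) / (real k)\<^sup>2"
      by (simp only: add_divide_distrib)
    then show ?thesis using k by (simp add: pos_le_divide_eq mult.commute)
  qed
  have R: "H / 4 + G / 4 = (real k)\<^sup>2 * B"
  proof -
    have "4 / x / 4 = 1 / x" for x :: real by simp
    then have "H / 4 = 1 / (2 - ((real m + 1) / real k)\<^sup>2)" unfolding H_def .
    moreover have "G / 4 = pi\<^sup>2 / 16 * (2 - (real m / real k)\<^sup>2)" by (simp add: G_def)
    moreover have "(real k)\<^sup>2 * B = 1 / (2 - ((real m + 1) / real k)\<^sup>2)
        + pi\<^sup>2 / 16 * (2 - (real m / real k)\<^sup>2)"
      using k by (simp add: B_def)
    ultimately show ?thesis by (simp only:)
  qed
  have "\<exists>i j. i \<le> m \<and> j \<le> Suc m \<and>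
    (real m + a) * ((1 - a) * (real m * (w - real i / real m)\<^sup>2)
      + a * ((real m + 1) * (w - real j / (real m + 1))\<^sup>2)) \<le> 1 / 4"
  proof (cases "m = 0")
    case True
    \<comment> \<open>The inner ring is the pole, whose azimuthal term vanishes with the factor
      \<open>real m\<close>. The next ring offers only w = 0 and w = 1, and the claim becomes (a (w
      - j))^2 \<le> 1/4.\<close>
    obtain j :: nat where j: "j \<le> 1" "\<bar>w - real j\<bar> \<le> 1 / 2"
    proof (cases "w \<le> 1 / 2")
      case True then show ?thesis using that[of 0] w by simp
    next
      case False then show ?thesis using that[of 1] w by simp
    qed
    have "(a * \<bar>w - real j\<bar>)\<^sup>2 \<le> (1 * (1 / 2))\<^sup>2"
      using a j by (intro power_mono mult_mono) auto
    then show ?thesis using True j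
      by (intro exI[of _ 0] exI[of _ j]) (simp add: power2_eq_square mult_ac)
  next
    case False
    then obtain i j where ij: "i \<le> m" "j \<le> Suc m"
      "\<bar>w - real i / real m\<bar> \<le> 1 / (2 * real m)"
      "\<bar>w - real j / (real m + 1)\<bar> \<le> 1 / (2 * (real m + 1))"
      "\<bar>w - real i / real m\<bar> + \<bar>w - real j / (real m + 1)\<bar> \<le> 1 / (real m + 1)"
      using interlacing_fractions[OF _ w] by blast
    have "real m \<ge> 1" using False by simp
    from weighted_gap_bound[OF this a _ ij(3) _ ij(4,5)] ij(1,2) show ?thesis
      by auto
  qed
  then obtain i j where ij: "i \<le> m" "j \<le> Suc m" and avg: "(real m + a) *
      ((1 - a) * (real m * (w - real i / real m)\<^sup>2)
      + a * ((real m + 1) * (w - real j / (real m + 1))\<^sup>2)) \<le> 1 / 4"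
    by blast
  have "0 \<le> (a - 1 / 2)\<^sup>2" by simp
  then have aa: "(1 - a) * a \<le> 1 / 4" by (simp add: power2_eq_square algebra_simps)
  have "(1 - a) * ((real k)\<^sup>2 * d m i) + a * ((real k)\<^sup>2 * d (Suc m) j)
    \<le> (1 - a) * (H * (a - (real m - real m))\<^sup>2 + G * ((real m + a) * (real m * (w - real i / real m)\<^sup>2)))
     + a * (H * (a - (real (Suc m) - real m))\<^sup>2
       + G * ((real m + a) * (real (Suc m) * (w - real j / real (Suc m))\<^sup>2)))"
    using a by (intro add_mono mult_left_mono d) auto
  \<comment> \<open>The radial squares a^2 and (1 - a)^2 average to (1 - a) a^2 + a (1 - a)^2 = a (1
    - a), which is at most 1/4.\<close>
  also have "\<dots> = H * ((1 - a) * a) + G * ((real m + a) *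
      ((1 - a) * (real m * (w - real i / real m)\<^sup>2)
      + a * ((real m + 1) * (w - real j / (real m + 1))\<^sup>2)))"
    unfolding of_nat_Suc add.commute[of 1 "real m"] by algebra
  also have "\<dots> \<le> H * (1 / 4) + G * (1 / 4)"
    by (intro add_mono mult_left_mono avg aa H0 G0)
  finally have "(1 - a) * ((real k)\<^sup>2 * d m i) + a * ((real k)\<^sup>2 * d (Suc m) j) \<le> (real k)\<^sup>2 * B"
    using R by simp
  then have "(real k)\<^sup>2 * d m i \<le> (real k)\<^sup>2 * B \<or> (real k)\<^sup>2 * d (Suc m) j \<le> (real k)\<^sup>2 * B"
    by (rule weighted_average_le[OF a])
  then have "d m i \<le> B \<or> d (Suc m) j \<le> B" using k by simp
  then show ?thesis
    using that[of i m] that[of j "Suc m"] ij m unfolding d_def by auto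
qed

text \<open>Here e = 1 / k and s is the inner ring. The convex function 1 / (2 - A) lies below its
  chord (1 + A) / 2 on the unit interval, and A \<le> s^2 + D. What remains is affine in s^2 and
  largest at s = 0; the excess from D is absorbed by 1 + D \<le> 1 / (1 - D).\<close>

lemma ring_bound_le:
  fixes s e :: real
  assumes e: "0 < e" "(1 + e)\<^sup>2 < 2" and s: "0 \<le> s" "s + e \<le> 1"
  shows "1 / (2 - (s + e)\<^sup>2) + pi\<^sup>2 / 16 * (2 - s\<^sup>2) \<le> (4 + pi\<^sup>2) / (8 * (2 - (1 + e)\<^sup>2))"
proof -
  define A where "A = (s + e)\<^sup>2"
  define D where "D = 2 * e + e\<^sup>2"
  have A: "0 \<le> A" "A \<le> 1" using assms by (auto simp: A_def intro: power_le_one)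
  have D: "0 < D" "D < 1" "2 - (1 + e)\<^sup>2 = 1 - D"
    using e by (simp add: D_def add_pos_nonneg) (use e in \<open>auto simp: D_def power2_eq_square algebra_simps\<close>)
  have "(1 / 2 + A / 2) * (2 - A) = 1 + A * (1 - A) / 2" by (simp add: field_simps)
  moreover have "0 \<le> A * (1 - A)" using A by simp
  ultimately have "1 \<le> (1 / 2 + A / 2) * (2 - A)" by linarith
  then have h1: "1 / (2 - A) \<le> 1 / 2 + A / 2" using A by (simp add: divide_le_eq)
  have "(1 + D) * (1 - D) \<le> 1" by (simp add: algebra_simps)
  then have "1 + D \<le> 1 / (1 - D)" using D by (simp add: le_divide_eq)
  then have "(1 / 2 + pi\<^sup>2 / 8) * (1 + D) \<le> (1 / 2 + pi\<^sup>2 / 8) * (1 / (1 - D))"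
    by (intro mult_left_mono) auto
  moreover have "(1 / 2 + P / 8) * (1 / X) = (4 + P) / (8 * X)" for P X :: real
    by (simp add: field_simps)
  ultimately have h2: "(1 / 2 + pi\<^sup>2 / 8) * (1 + D) \<le> (4 + pi\<^sup>2) / (8 * (1 - D))" by metis
  \<comment> \<open>This makes the coefficient 1/2 - \<pi>^2 / 16 of s^2 nonpositive, so the pole is
    the worst place.\<close>
  have pi8: "pi\<^sup>2 \<ge> 8"
    using power_mono[OF pi_approx(1), of 2] by (simp add: power2_eq_square)
  have "s * e \<le> 1 * e" using s e by (intro mult_right_mono) auto
  then have "A \<le> s\<^sup>2 + D" by (simp add: A_def D_def power2_eq_square algebra_simps)
  moreover have "8 * s\<^sup>2 \<le> pi\<^sup>2 * s\<^sup>2" using pi8 by (intro mult_right_mono) auto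
  moreover have "0 \<le> pi\<^sup>2 * D" using D by simp
  moreover have "1 / 2 + A / 2 + P / 16 * (2 - S) \<le> (1 / 2 + P / 8) * (1 + D)"
    if "A \<le> S + D" "8 * S \<le> P * S" "0 \<le> P * D" for P S :: real
    using that by (simp add: field_simps)
  ultimately have "1 / 2 + A / 2 + pi\<^sup>2 / 16 * (2 - s\<^sup>2) \<le> (1 / 2 + pi\<^sup>2 / 8) * (1 + D)"
    by blast
  then show ?thesis using h1 h2 unfolding D(3) A_def by linarith
qed

section \<open>From a single strip to the whole sphere\<close>

lemma octa_point_polar:
  fixes y :: "real^3"
  assumes y: "norm y = 1" "0 \<le> y$1" "0 \<le> y$2" "0 \<le> y$3"
  obtains s w where "0 \<le> s" "s \<le> 1" "0 \<le> w" "w \<le> 1" "y = octa_point s (pi / 2 * w)"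
proof -
  have n: "(y$1)\<^sup>2 + (y$2)\<^sup>2 + (y$3)\<^sup>2 = 1"
    using dist_vec3_sq[of y 0] y by simp
  have "(y$3)\<^sup>2 \<le> 1" using n zero_le_power2[of "y$1"] zero_le_power2[of "y$2"] by linarith
  then have y3: "y$3 \<le> 1" using power2_le_imp_le[of "y$3" 1] by simp
  define s where "s = sqrt (1 - y$3)"
  have s: "0 \<le> s" "s \<le> 1" "s\<^sup>2 = 1 - y$3" using y3 y by (auto simp: s_def)
  define r where "r = s * sqrt (2 - s\<^sup>2)"
  have r0: "0 \<le> r" using s y by (simp add: r_def)
  have r: "r\<^sup>2 = (y$1)\<^sup>2 + (y$2)\<^sup>2"
  proof -
    have "r\<^sup>2 = s\<^sup>2 * (2 - s\<^sup>2)" using s y by (simp add: r_def power_mult_distrib)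
    then show ?thesis unfolding s(3) using n by algebra
  qed
  have "\<exists>w. 0 \<le> w \<and> w \<le> 1 \<and> y$1 = r * cos (pi / 2 * w) \<and> y$2 = r * sin (pi / 2 * w)"
  proof (cases "r = 0")
    case True
    then have "y$1 = 0" "y$2 = 0" using r by (auto simp: sum_power2_eq_zero_iff)
    then show ?thesis using True by (intro exI[of _ 0]) auto
  next
    case False
    then have "(y$1 / r)\<^sup>2 + (y$2 / r)\<^sup>2 = 1"
      unfolding power_divide add_divide_distrib[symmetric] r[symmetric] using False by simp
    then obtain t where t: "0 \<le> t" "t \<le> pi / 2" "y$1 / r = cos t" "y$2 / r = sin t"
      using sincos_total_pi_half[of "y$1 / r" "y$2 / r"] y r0 by auto
    then show ?thesis using False
      by (intro exI[of _ "2 * t / pi"]) (auto simp: field_simps)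
  qed
  then obtain w where w: "0 \<le> w" "w \<le> 1" and y12: "y$1 = r * cos (pi / 2 * w)" "y$2 = r * sin (pi / 2 * w)"
    by blast
  have y3': "y$3 = 1 - s\<^sup>2" using s by simp
  have "y = octa_point s (pi / 2 * w)"
    unfolding vec_eq_iff forall_3 octa_point_def vector_3 y12 y3' r_def by simp
  then show ?thesis using that[OF s(1,2) w] by blast
qed

lemma octa_config_covers:
  assumes k: "k \<ge> 3" and y: "norm y = 1"
  obtains x where "x \<in> octa_config k"
    "(dist x y)\<^sup>2 \<le> (4 + pi\<^sup>2) / (8 * (2 - (real k + 1)\<^sup>2 / (real k)\<^sup>2)) / (real k)\<^sup>2"
proof -
  have k0: "k > 0" using k by simp
  \<comment> \<open>Signs that reflect y into the closed octant. Zero coordinates get sign 1, so the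
    reflection is its own inverse.\<close>
  define \<sigma> where "\<sigma> i = (if y$i < 0 then -1 else 1 :: real)" for i
  have \<sigma>: "\<sigma> i \<in> {-1, 1}" for i by (simp add: \<sigma>_def)
  define z where "z = flip (\<sigma> 1) (\<sigma> 2) (\<sigma> 3) y"
  have yz: "y = flip (\<sigma> 1) (\<sigma> 2) (\<sigma> 3) z"
    by (simp add: z_def flip_def \<sigma>_def vec_eq_iff forall_3)
  have "norm z = 1" unfolding z_def using y norm_flip[OF \<sigma> \<sigma> \<sigma>] by simp
  moreover have "0 \<le> z$1" "0 \<le> z$2" "0 \<le> z$3" by (simp_all add: z_def flip_def \<sigma>_def)
  ultimately obtain s w where s: "0 \<le> s" "s \<le> 1" and w: "0 \<le> w" "w \<le> 1"
    and z: "z = octa_point s (pi / 2 * w)"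
    by (rule octa_point_polar)
  obtain m where m: "m < k" "real m / real k \<le> s" "s \<le> (real m + 1) / real k"
  proof (cases "s = 1")
    case True
    then show ?thesis using that[of "k - 1"] k0 by (simp add: of_nat_diff)
  next
    case False
    then have "real k * s < real k" using k0 s by simp
    then have "nat \<lfloor>real k * s\<rfloor> < k" using s by (simp add: floor_less_iff nat_less_iff)
    moreover have "real (nat \<lfloor>real k * s\<rfloor>) \<le> real k * s" using s by simp
    moreover have "real k * s \<le> real (nat \<lfloor>real k * s\<rfloor>) + 1" using s by linarith
    ultimately show ?thesis using that[of "nat \<lfloor>real k * s\<rfloor>"] k0
      by (simp add: field_simps)
  qed
  obtain n j where nj: "j \<le> n" "n \<le> k" and
    d: "(dist z (octa_point (real n / real k) (pi * real j / (2 * real n))))\<^sup>2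
      \<le> (1 / (2 - ((real m + 1) / real k)\<^sup>2) + pi\<^sup>2 / 16 * (2 - (real m / real k)\<^sup>2)) / (real k)\<^sup>2"
    using ring_pair_covers[OF k0 m w] unfolding z by blast
  define x where "x = flip (\<sigma> 1) (\<sigma> 2) (\<sigma> 3) (octa_point (real n / real k) (pi * real j / (2 * real n)))"
  have "x \<in> octa_config k"
    unfolding octa_config_eq[OF k0] x_def using nj \<sigma> by blast
  moreover have "(dist x y)\<^sup>2 \<le> (4 + pi\<^sup>2) / (8 * (2 - (real k + 1)\<^sup>2 / (real k)\<^sup>2)) / (real k)\<^sup>2"
  proof -
    define e where "e = 1 / real k"
    have e: "0 < e" "e \<le> 1 / 3" using k by (auto simp: e_def field_simps)
    \<comment> \<open>This is where k \<ge> 3 enters: (4/3)^2 = 16/9 < 2, whereas k = 2 would give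
      (3/2)^2 > 2.\<close>
    have "(1 + e)\<^sup>2 \<le> (1 + 1 / 3)\<^sup>2" using e by (intro power_mono) auto
    then have e2: "(1 + e)\<^sup>2 < 2" by (simp add: power2_eq_square)
    have me: "(real m + 1) / real k = real m / real k + e" by (simp add: e_def add_divide_distrib)
    have "(real m + 1) / real k \<le> 1" using m k0 by simp
    then have me1: "real m / real k + e \<le> 1" using me by simp
    have ke: "(real k + 1)\<^sup>2 / (real k)\<^sup>2 = (1 + e)\<^sup>2"
      using k0 by (simp add: e_def add_divide_distrib flip: power_divide)
    have "(dist x y)\<^sup>2 = (dist z (octa_point (real n / real k) (pi * real j / (2 * real n))))\<^sup>2"
      unfolding x_def by (subst yz) (simp only: dist_flip \<sigma> dist_commute)
    also note d
    also have "(1 / (2 - ((real m + 1) / real k)\<^sup>2) + pi\<^sup>2 / 16 * (2 - (real m / real k)\<^sup>2)) / (real k)\<^sup>2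
       \<le> (4 + pi\<^sup>2) / (8 * (2 - (real k + 1)\<^sup>2 / (real k)\<^sup>2)) / (real k)\<^sup>2"
      unfolding me ke by (intro divide_right_mono ring_bound_le e e2 me1) auto
    finally show ?thesis .
  qed
  ultimately show ?thesis by (rule that)
qed

lemma covering_radius_octa_config_le:
  assumes k: "k \<ge> 3"
  shows "covering_radius (octa_config k)
    \<le> sqrt ((4 + pi\<^sup>2) / (8 * (2 - (real k + 1)\<^sup>2 / (real k)\<^sup>2)) / (real k)\<^sup>2)"
  unfolding covering_radius_def
proof (rule cSUP_least)
  show "sphere (0::real^3) 1 \<noteq> {}" by simp
  fix y :: "real^3" assume "y \<in> sphere 0 1"
  then have "norm y = 1" by simp
  from octa_config_covers[OF k this] obtain x where x: "x \<in> octa_config k"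
    "(dist x y)\<^sup>2 \<le> (4 + pi\<^sup>2) / (8 * (2 - (real k + 1)\<^sup>2 / (real k)\<^sup>2)) / (real k)\<^sup>2" .
  have "Min ((\<lambda>x. dist x y) ` octa_config k) \<le> dist x y"
    using finite_octa_config k x by (intro Min_le) auto
  also have "\<dots> \<le> sqrt ((4 + pi\<^sup>2) / (8 * (2 - (real k + 1)\<^sup>2 / (real k)\<^sup>2)) / (real k)\<^sup>2)"
    using x by (intro real_le_rsqrt)
  finally show "Min ((\<lambda>x. dist x y) ` octa_config k) \<le> \<dots>" .
qed

subsection \<open>Separation\<close>

lemma separation_ge:
  assumes "configuration \<omega>" "\<And>x y. x \<in> \<omega> \<Longrightarrow> y \<in> \<omega> \<Longrightarrow> x \<noteq> y \<Longrightarrow> d \<le> dist x y"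
  shows "d \<le> separation \<omega>"
proof -
  let ?S = "{dist x y | x y. x \<in> \<omega> \<and> y \<in> \<omega> \<and> x \<noteq> y}"
  have fin: "finite \<omega>" and c: "card \<omega> \<ge> 2" using assms(1) by (auto simp: configuration_def)
  have "?S \<subseteq> (\<lambda>(x, y). dist x y) ` (\<omega> \<times> \<omega>)" by auto
  then have "finite ?S" using fin by (simp add: finite_subset)
  moreover have "?S \<noteq> {}"
  proof -
    have "\<not> card \<omega> \<le> Suc 0" using c by simp
    then obtain x y where "x \<in> \<omega>" "y \<in> \<omega>" "x \<noteq> y" using card_le_Suc0_iff_eq[OF fin] by blast
    then show ?thesis by blast
  qed
  ultimately show ?thesis
    unfolding separation_def using assms(2) by (subst Min_ge_iff) auto
qed

lemma dist_north_pole: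
  fixes x :: "real^3"
  assumes "norm x = 1" shows "dist x (vector [0, 0, 1]) = sqrt (2 - 2 * x$3)"
proof -
  have "(x$1)\<^sup>2 + (x$2)\<^sup>2 + (x$3)\<^sup>2 = 1"
    using dist_vec3_sq[of x 0] assms by simp
  then have "(dist x (vector [0, 0, 1]))\<^sup>2 = 2 - 2 * x$3"
    unfolding dist_vec3_sq by (simp add: power2_eq_square algebra_simps)
  then show ?thesis by (metis real_sqrt_unique zero_le_dist)
qed

text \<open>Reverse triangle inequality through the north pole. Only an upper bound on the height of
  y is assumed, so that every lower point, also one beyond the equator, is covered.\<close>

lemma dist_consecutive_rings:
  fixes x y :: "real^3"
  assumes "norm x = 1" "norm y = 1" "k > 0"
    and x: "x$3 = 1 - (real m / real k)\<^sup>2" and y: "y$3 \<le> 1 - ((real m + 1) / real k)\<^sup>2"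
  shows "sqrt 2 / real k \<le> dist x y"
proof -
  have dx: "dist x (vector [0, 0, 1]) = sqrt 2 * (real m / real k)"
    unfolding dist_north_pole[OF assms(1)] x by (simp add: real_sqrt_mult flip: right_diff_distrib)
  have "sqrt 2 * ((real m + 1) / real k) = sqrt (2 * ((real m + 1) / real k)\<^sup>2)"
    by (simp add: real_sqrt_mult)
  also have "\<dots> \<le> dist y (vector [0, 0, 1])"
    unfolding dist_north_pole[OF assms(2)] using y by (intro real_sqrt_le_mono) linarith
  finally have "sqrt 2 * ((real m + 1) / real k) - sqrt 2 * (real m / real k) \<le> dist x y"
    using dx dist_triangle[of y "vector [0, 0, 1]" x] by (simp add: dist_commute)
  then show ?thesis by (simp add: add_divide_distrib algebra_simps)
qed

section \<open>Points on a common ring\<close>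

lemma abs_sin_multiple_le: "\<bar>sin (real n * x)\<bar> \<le> real n * \<bar>sin x\<bar>"
proof (induction n)
  case (Suc n)
  have "\<bar>sin (real (Suc n) * x)\<bar> = \<bar>sin (real n * x) * cos x + cos (real n * x) * sin x\<bar>"
    unfolding of_nat_Suc distrib_right sin_add by (simp add: add.commute mult.commute)
  also have "\<dots> \<le> \<bar>sin (real n * x)\<bar> * \<bar>cos x\<bar> + \<bar>cos (real n * x)\<bar> * \<bar>sin x\<bar>"
    by (metis abs_mult abs_triangle_ineq)
  also have "\<dots> \<le> \<bar>sin (real n * x)\<bar> * 1 + 1 * \<bar>sin x\<bar>"
    by (intro add_mono mult_mono) auto
  finally show ?case using Suc by (simp add: algebra_simps)
qed simp

text \<open>|sin| has period \<pi>, which is 4 m steps of \<epsilon> = \<pi> / (4 m). Reducing D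
  modulo 4 m leaves a nonzero residue, hence an angle between \<epsilon> and \<pi> - \<epsilon>,
  where the sine is at least sin \<epsilon>.\<close>

lemma sin_grid_ge:
  fixes D :: int
  assumes m: "m > 0" and nz: "sin (pi * D / (4 * real m)) \<noteq> 0"
  shows "sqrt 2 / 2 \<le> real m * \<bar>sin (pi * D / (4 * real m))\<bar>"
proof -
  define N where "N = 4 * int m"
  define r where "r = D mod N"
  define q where "q = D div N"
  define \<epsilon> where "\<epsilon> = pi / (4 * real m)"
  have N0: "N > 0" using m by (simp add: N_def)
  have "D = q * N + r" by (simp add: q_def r_def)
  then have "pi * D / (4 * real m) = pi * r / (4 * real m) + of_int q * pi"
    using m by (simp add: N_def field_simps)
  then have eq: "\<bar>sin (pi * D / (4 * real m))\<bar> = \<bar>sin (real_of_int r * \<epsilon>)\<bar>"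
    by (simp add: sin_add abs_mult \<epsilon>_def mult_ac)
  have r0: "0 \<le> r" "r < N" using N0 by (auto simp: r_def)
  have "r \<noteq> 0" using eq nz by auto
  then have r1: "1 \<le> r" using r0 by simp
  have \<epsilon>: "0 < \<epsilon>" "real m * \<epsilon> = pi / 4" "N * \<epsilon> = pi" using m by (auto simp: \<epsilon>_def N_def)
  have \<epsilon>2: "\<epsilon> \<le> pi / 2" unfolding \<epsilon>_def using m by (intro divide_left_mono) auto
  have lo: "\<epsilon> \<le> r * \<epsilon>" using r1 \<epsilon> by simp
  have "(real_of_int r + 1) * \<epsilon> \<le> N * \<epsilon>" using r0 \<epsilon> by (intro mult_right_mono) linarith+
  then have hi: "\<epsilon> \<le> pi - r * \<epsilon>" using \<epsilon>(3) by (simp add: algebra_simps)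
  have "sin \<epsilon> \<le> sin (r * \<epsilon>)"
  proof (cases "r * \<epsilon> \<le> pi / 2")
    case True
    then show ?thesis using lo \<epsilon>(1) pi_gt_zero by (intro sin_monotone_2pi_le; linarith)
  next
    case False
    then have "sin \<epsilon> \<le> sin (pi - r * \<epsilon>)" using hi \<epsilon>(1) pi_gt_zero by (intro sin_monotone_2pi_le; linarith)
    then show ?thesis by simp
  qed
  then have "\<bar>sin \<epsilon>\<bar> \<le> \<bar>sin (r * \<epsilon>)\<bar>"
    using \<epsilon> \<epsilon>2 sin_ge_zero[of \<epsilon>] by simp
  then have "real m * \<bar>sin \<epsilon>\<bar> \<le> real m * \<bar>sin (r * \<epsilon>)\<bar>" by (intro mult_left_mono) auto
  \<comment> \<open>As m \<epsilon> = \<pi>/4, this gives a lower bound for m sin \<epsilon> that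
    does not depend on m.\<close>
  moreover have "\<bar>sin (real m * \<epsilon>)\<bar> \<le> real m * \<bar>sin \<epsilon>\<bar>" by (rule abs_sin_multiple_le)
  ultimately show ?thesis unfolding eq \<epsilon>(2) by (simp add: sin_45)
qed

text \<open>The horizontal reflections act on the azimuth by \<phi> to \<pi> - \<phi>, -\<phi> and
  \<pi> + \<phi>, thus on the index by j to 2 m - j, -j and 2 m + j. All four quadrants of a ring
  become one equally spaced family.\<close>

lemma flip_octa_point_angle:
  assumes "s1 \<in> {-1, 1}" "s2 \<in> {-1, 1}" "m > 0"
  obtains J :: int where
    "flip s1 s2 s3 (octa_point s (pi * real j / (2 * real m)))
      = flip 1 1 s3 (octa_point s (pi * J / (2 * real m)))"
proof -
  let ?t = "pi * real j / (2 * real m)"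
  have a: "pi * real_of_int (2 * int m - int j) / (2 * real m) = pi - ?t"
    "pi * real_of_int (2 * int m + int j) / (2 * real m) = pi + ?t"
    "pi * real_of_int (- int j) / (2 * real m) = - ?t"
    using \<open>m > 0\<close> by (auto simp: field_simps)
  have "s1 = 1 \<and> s2 = 1 \<or> s1 = -1 \<and> s2 = 1 \<or> s1 = 1 \<and> s2 = -1 \<or> s1 = -1 \<and> s2 = -1"
    using assms by auto
  then show ?thesis
  proof (elim disjE conjE)
    assume "s1 = 1" "s2 = 1"
    then show ?thesis using that[of "int j"] by simp
  next
    assume "s1 = -1" "s2 = 1"
    then show ?thesis using that[of "2 * int m - int j", unfolded a]
      by (simp add: flip_def octa_point_def)
  next
    assume "s1 = 1" "s2 = -1"
    then show ?thesis using that[of "- int j", unfolded a]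
      by (simp add: flip_def octa_point_def)
  next
    assume "s1 = -1" "s2 = -1"
    then show ?thesis using that[of "2 * int m + int j", unfolded a]
      by (simp add: flip_def octa_point_def)
  qed
qed

text \<open>The squared chord is 4 s^2 (2 - s^2) sin^2 \<theta> with \<theta> half the azimuth
  difference. The grid bound gives s^2 sin^2 \<theta> \<ge> 1 / (2 k^2), and 2 - s^2 \<ge>
  1.\<close>

lemma dist_within_ring:
  fixes J J' :: int
  assumes k: "k > 0" "m > 0" "m \<le> k"
  defines "P \<equiv> \<lambda>J::int. octa_point (real m / real k) (pi * J / (2 * real m))"
  assumes ne: "P J \<noteq> P J'"
  shows "sqrt 2 / real k \<le> dist (P J) (P J')"
proof -
  define s where "s = real m / real k"
  define \<theta> where "\<theta> = pi * (J - J') / (4 * real m)"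
  have s: "0 < s" "s\<^sup>2 \<le> 1" using k by (auto simp: s_def intro!: power_le_one)
  have th: "pi * J / (2 * real m) - pi * J' / (2 * real m) = 2 * \<theta>"
    using k by (simp add: \<theta>_def field_simps)
  have s2: "s\<^sup>2 \<le> 2" using s by simp
  have "(dist (P J) (P J'))\<^sup>2 = 2 * (s * sqrt (2 - s\<^sup>2)) * (s * sqrt (2 - s\<^sup>2)) * (1 - cos (2 * \<theta>))"
    unfolding P_def s_def[symmetric] dist_octa_point_sq[OF s2 s2] th by simp
  also have "\<dots> = 4 * (s\<^sup>2 * (2 - s\<^sup>2)) * (sin \<theta>)\<^sup>2"
    unfolding cos_double_sin using s by (simp add: power2_eq_square)
  finally have d: "(dist (P J) (P J'))\<^sup>2 = 4 * (s\<^sup>2 * (2 - s\<^sup>2)) * (sin \<theta>)\<^sup>2" .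
  then have "sin \<theta> \<noteq> 0" using ne by auto
  then have "sqrt 2 / 2 \<le> real m * \<bar>sin \<theta>\<bar>"
    unfolding \<theta>_def using sin_grid_ge[OF k(2), of "J - J'"] by simp
  then have "(sqrt 2 / 2)\<^sup>2 \<le> (real m * \<bar>sin \<theta>\<bar>)\<^sup>2" by (intro power_mono) auto
  then have "1 / 2 \<le> (real m)\<^sup>2 * (sin \<theta>)\<^sup>2" by (simp add: power_mult_distrib power_divide)
  then have "1 / 2 / (real k)\<^sup>2 \<le> (real m)\<^sup>2 * (sin \<theta>)\<^sup>2 / (real k)\<^sup>2"
    by (intro divide_right_mono) auto
  then have A: "1 / 2 / (real k)\<^sup>2 \<le> s\<^sup>2 * (sin \<theta>)\<^sup>2" by (simp add: s_def power_divide)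
  have "s\<^sup>2 * (sin \<theta>)\<^sup>2 * 1 \<le> s\<^sup>2 * (sin \<theta>)\<^sup>2 * (2 - s\<^sup>2)" using s by (intro mult_left_mono) auto
  with A d have "2 / (real k)\<^sup>2 \<le> (dist (P J) (P J'))\<^sup>2" by (simp add: mult_ac)
  then have "sqrt (2 / (real k)\<^sup>2) \<le> dist (P J) (P J')" by (intro real_le_lsqrt) auto
  then show ?thesis by (simp add: real_sqrt_divide)
qed

lemma dist_octa_config_ge:
  assumes k: "k > 0" and x: "x \<in> octa_config k" and y: "y \<in> octa_config k" and ne: "x \<noteq> y"
  shows "sqrt 2 / real k \<le> dist x y"
proof -
  have nrm: "norm z = 1" if "z \<in> octa_config k" for z
    using configuration_octa_config[OF k] that by (auto simp: configuration_def)
  have ring: "\<exists>m\<le>k. z$3 = 1 - (real m / real k)\<^sup>2 \<or> z$3 = - (1 - (real m / real k)\<^sup>2)"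
    if z: "z \<in> octa_config k" for z
    using z unfolding octa_config_eq[OF k] by (auto simp: flip_def octa_point_def)
  have le1: "(real m / real k)\<^sup>2 \<le> 1" if "m \<le> k" for m
    using that k by (intro power_le_one) auto
  have lt: "m < n \<and> ((real m + 1) / real k)\<^sup>2 \<le> (real n / real k)\<^sup>2"
    if "(real m / real k)\<^sup>2 < (real n / real k)\<^sup>2" for m n
  proof -
    have "m < n" using that k by (auto dest!: power2_less_imp_less simp: divide_less_cancel)
    then show ?thesis using k by (auto intro!: power_mono divide_right_mono)
  qed
  have diff: "sqrt 2 / real k \<le> dist x y"
    if x: "x \<in> octa_config k" and y: "y \<in> octa_config k" and xy: "y$3 < x$3" for x y
  proof (cases "x$3 > 0")
    case True
    then obtain m where m: "m \<le> k" "x$3 = 1 - (real m / real k)\<^sup>2" using ring[OF x] le1 by force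
    have "y$3 \<le> 1 - ((real m + 1) / real k)\<^sup>2"
    proof (cases "y$3 > 0")
      case y0: True
      then obtain n where "n \<le> k" "y$3 = 1 - (real n / real k)\<^sup>2" using ring[OF y] le1 by force
      then show ?thesis using lt[of m n] xy m by auto
    next
      case False
      \<comment> \<open>The equator is ring k. As x lies above it, m + 1 \<le> k, so the required
        height bound for y is nonnegative.\<close>
      have "(real m / real k)\<^sup>2 < (real k / real k)\<^sup>2" using True m k by simp
      from lt[OF this] show ?thesis using False k by simp
    qed
    then show ?thesis using dist_consecutive_rings nrm x y k m by blast
  next
    case False
    \<comment> \<open>The antipodal map exchanges the roles of x and y and leads back to a point
      above the equator.\<close>
    then have y0: "y$3 < 0" using xy by simp
    then obtain n where n: "n \<le> k" "- (y$3) = 1 - (real n / real k)\<^sup>2" using ring[OF y] le1 by force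
    have "- (x$3) \<le> 1 - ((real n + 1) / real k)\<^sup>2"
    proof (cases "x$3 < 0")
      case True
      then obtain m where "m \<le> k" "- (x$3) = 1 - (real m / real k)\<^sup>2" using ring[OF x] le1 by force
      then show ?thesis using lt[of n m] xy n by auto
    next
      case x0: False
      have "(real n / real k)\<^sup>2 < (real k / real k)\<^sup>2" using y0 n k by simp
      from lt[OF this] show ?thesis using False x0 k by simp
    qed
    then have "sqrt 2 / real k \<le> dist (- y) (- x)"
      using n nrm x y k by (intro dist_consecutive_rings[of "- y" "- x" k n]) auto
    then show ?thesis by (simp add: dist_minus dist_commute)
  qed
  show ?thesis
  proof (cases "x$3 = y$3")
    case False
    then show ?thesis using diff[OF x y] diff[OF y x] by (force simp: dist_commute)
  next
    case True
    obtain s1 s2 s3 m j where s: "s1 \<in> {-1, 1}" "s2 \<in> {-1, 1}" "s3 \<in> {-1, 1}" and m: "m \<le> k"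
      and xe: "x = flip s1 s2 s3 (octa_point (real m / real k) (pi * real j / (2 * real m)))"
      using x unfolding octa_config_eq[OF k] by blast
    obtain t1 t2 t3 n i where t: "t1 \<in> {-1, 1}" "t2 \<in> {-1, 1}" "t3 \<in> {-1, 1}" and n: "n \<le> k"
      and ye: "y = flip t1 t2 t3 (octa_point (real n / real k) (pi * real i / (2 * real n)))"
      using y unfolding octa_config_eq[OF k] by blast
    have x3: "x$3 = s3 * (1 - (real m / real k)\<^sup>2)" and y3: "y$3 = t3 * (1 - (real n / real k)\<^sup>2)"
      by (simp_all add: xe ye flip_def octa_point_def)
    have "A = B" if "a * (1 - A) = b * (1 - B)" "a \<in> {-1, 1}" "b \<in> {-1, 1}" "A \<le> 1" "B \<le> 1"
      for a b A B :: real using that by auto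
    from this[OF True[unfolded x3 y3] s(3) t(3) le1[OF m] le1[OF n]]
    have "(real m / real k)\<^sup>2 = (real n / real k)\<^sup>2" .
    then have mn: "m = n" using k by (simp add: power_divide power2_eq_iff_nonneg)
    \<comment> \<open>On the equator s3 and t3 may differ, but both then multiply the height 0; so y
      can be written with s3 in every case.\<close>
    have "t3 * (1 - (real n / real k)\<^sup>2) = s3 * (1 - (real n / real k)\<^sup>2)"
      using True unfolding x3 y3 mn by (rule sym)
    then have ye: "y = flip t1 t2 s3 (octa_point (real m / real k) (pi * real i / (2 * real m)))"
      unfolding ye mn flip_def octa_point_def vector_3 by (simp only:)
    have "m > 0"
    proof (rule ccontr)
      assume "\<not> m > 0"
      then show False using ne unfolding xe ye by (simp add: flip_def octa_point_def)
    qed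
    obtain J where xJ: "x = flip 1 1 s3 (octa_point (real m / real k) (pi * real_of_int J / (2 * real m)))"
      using flip_octa_point_angle[OF s(1,2) \<open>m > 0\<close>] unfolding xe by metis
    obtain I where yI: "y = flip 1 1 s3 (octa_point (real m / real k) (pi * real_of_int I / (2 * real m)))"
      using flip_octa_point_angle[OF t(1,2) \<open>m > 0\<close>] unfolding ye by metis
    have "octa_point (real m / real k) (pi * real_of_int J / (2 * real m))
        \<noteq> octa_point (real m / real k) (pi * real_of_int I / (2 * real m))"
      using ne unfolding xJ yI by auto
    from dist_within_ring[OF k \<open>m > 0\<close> m this] show ?thesis
      unfolding xJ yI by (subst dist_flip) (use s(3) in auto)
  qed
qed

lemma separation_octa_config_ge: "k > 0 \<Longrightarrow> sqrt 2 / real k \<le> separation (octa_config k)"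
  by (intro separation_ge configuration_octa_config dist_octa_config_ge)

subsection \<open>Mesh ratio\<close>

lemma limit_numerics: "\<bar>sqrt (4 + pi\<^sup>2) / 4 - 0.931048\<bar> \<le> 5 / 10 ^ 7"
proof -
  \<comment> \<open>The end points are 4 * 0.9310475 and 4 * 0.9310485, half a unit of the sixth
    decimal on either side.\<close>
  have "3.7241900\<^sup>2 \<le> 4 + pi\<^sup>2"
    using power_mono[OF pi_approx(1), of 2] by (simp add: power2_eq_square)
  moreover have "4 + pi\<^sup>2 \<le> 3.7241940\<^sup>2"
    using power_mono[OF pi_approx(2), of 2] by (simp add: power2_eq_square)
  ultimately have "3.7241900 \<le> sqrt (4 + pi\<^sup>2)" "sqrt (4 + pi\<^sup>2) \<le> 3.7241940"
    by (intro real_le_rsqrt real_le_lsqrt; simp)+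
  then show ?thesis unfolding abs_le_iff by auto
qed

lemma bound_tendsto:
  "(\<lambda>k::nat. 1 / 4 * sqrt ((4 + pi\<^sup>2) / (2 - (real k + 1)\<^sup>2 / (real k)\<^sup>2)))
        \<longlonglongrightarrow> sqrt (4 + pi\<^sup>2) / 4"
proof -
  have "(\<lambda>k. (real k + 1)\<^sup>2 / (real k)\<^sup>2) \<longlonglongrightarrow> 1" 
    by real_asymp
  then have "(\<lambda>k::nat. 1 / 4 * sqrt ((4 + pi\<^sup>2) / (2 - (real k + 1)\<^sup>2 / (real k)\<^sup>2)))
        \<longlonglongrightarrow> 1 / 4 * sqrt ((4 + pi\<^sup>2) / (2 - 1))"
    by (intro tendsto_intros) auto
  then show ?thesis by simp
qed

lemma separation_octa_config_pos:
  assumes "k > 0" shows "separation (octa_config k) > 0"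
proof -
  have "0 < sqrt 2 / real k" using assms by simp
  then show ?thesis using separation_octa_config_ge[OF assms] by linarith
qed

lemma covering_radius_nonneg:
  assumes "configuration \<omega>" shows "0 \<le> covering_radius \<omega>"
proof -
  have \<omega>: "finite \<omega>" "\<omega> \<noteq> {}" and sub: "\<omega> \<subseteq> sphere 0 1" using assms by (auto simp: configuration_def)
  obtain x where x: "x \<in> \<omega>" using \<omega> by blast
  let ?f = "\<lambda>y. Min ((\<lambda>x. dist x y) ` \<omega>)"
  \<comment> \<open>The diameter bounds the set of distances, so that the supremum really dominates
    each of its values.\<close>
  have "?f y \<le> 2" if "y \<in> sphere 0 1" for y
  proof -
    have "?f y \<le> dist x y" using \<omega> x by (intro Min_le) auto
    also have "\<dots> \<le> norm x + norm y" by (simp add: dist_norm norm_triangle_ineq4)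
    finally show ?thesis using x sub that by auto
  qed
  then have "bdd_above (?f ` sphere 0 1)" by (intro bdd_aboveI2[of _ _ 2])
  moreover have "x \<in> sphere 0 1" using x sub by blast
  ultimately have "?f x \<le> covering_radius \<omega>"
    unfolding covering_radius_def by (intro cSUP_upper)
  moreover have "0 \<le> ?f x" using \<omega> by (subst Min_ge_iff) auto
  ultimately show ?thesis by linarith
qed

lemma mesh_ratio_octa_config_nonneg: "k > 0 \<Longrightarrow> 0 \<le> mesh_ratio (octa_config k)"
  unfolding mesh_ratio_def
  using covering_radius_nonneg[OF configuration_octa_config] separation_octa_config_pos
  by (simp add: less_imp_le)

lemma mesh_ratio_octa_config_le:
  assumes k: "k \<ge> 3"
  shows "mesh_ratio (octa_config k)
    \<le> 1 / 4 * sqrt ((4 + pi\<^sup>2) / (2 - (real k + 1)\<^sup>2 / (real k)\<^sup>2))"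
proof -
  have k0: "k > 0" using k by simp
  define X where "X = (4 + pi\<^sup>2) / (2 - (real k + 1)\<^sup>2 / (real k)\<^sup>2)"
  have "mesh_ratio (octa_config k) \<le> covering_radius (octa_config k) / (sqrt 2 / real k)"
    unfolding mesh_ratio_def using k0 separation_octa_config_pos[OF k0]
    by (intro divide_left_mono separation_octa_config_ge covering_radius_nonneg
        configuration_octa_config mult_pos_pos) auto
  also have "\<dots> \<le> sqrt (X / 8 / (real k)\<^sup>2) / (sqrt 2 / real k)"
    using covering_radius_octa_config_le[OF k] k0
    by (intro divide_right_mono) (auto simp: X_def mult.commute)
  \<comment> \<open>The factors 1 / k cancel, and 8 * 2 = 4^2 produces the constant 1/4.\<close>
  also have "\<dots> = sqrt (X / 8) / sqrt 2"
    unfolding real_sqrt_divide[of "X / 8"] using k0 by simp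
  also have "\<dots> = sqrt (X / 4\<^sup>2)"
    by (simp flip: real_sqrt_divide)
  also have "\<dots> = 1 / 4 * sqrt X"
    by (simp add: real_sqrt_divide)
  finally show ?thesis unfolding X_def .
qed

lemma quasi_uniform_octa_config: "quasi_uniform (\<lambda>n. octa_config (Suc n))"
proof -
  let ?b = "\<lambda>k::nat. 1 / 4 * sqrt ((4 + pi\<^sup>2) / (2 - (real k + 1)\<^sup>2 / (real k)\<^sup>2))"
  have "filterlim (\<lambda>n. card (octa_config (Suc n))) at_top sequentially"
  proof (rule filterlim_at_top_mono[OF filterlim_ident])
    show "\<forall>\<^sub>F n in sequentially. n \<le> card (octa_config (Suc n))"
      using card_octa_config[of "Suc n" for n] by (intro always_eventually) (metis Suc_lessD less_imp_le zero_less_Suc)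
  qed
  moreover have "Bseq (\<lambda>n. mesh_ratio (octa_config (Suc n)))"
  proof -
    have "Bseq ?b" using bound_tendsto by (intro convergent_imp_Bseq convergentI)
    then have "Bseq (\<lambda>k. mesh_ratio (octa_config k))"
    proof (rule Bseq_eventually_mono[rotated])
      \<comment> \<open>The bound is available from k = 3 on; finitely many earlier terms do not
        affect boundedness.\<close>
      show "\<forall>\<^sub>F k in sequentially. norm (mesh_ratio (octa_config k)) \<le> norm (?b k)"
        using eventually_ge_at_top[of 3]
      proof eventually_elim
        case (elim k)
        then show ?case
          using mesh_ratio_octa_config_nonneg[of k] mesh_ratio_octa_config_le[OF elim] by simp
      qed
    qed
    then show ?thesis by (subst Bseq_Suc_iff)
  qed
  ultimately show ?thesis
    unfolding quasi_uniform_def using configuration_octa_config by simp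
qed

text \<open>For k = 1 and k = 2 the radicand is negative, so the inequality is stated from k = 3 on.
  The shift by \<open>Suc\<close> starts the sequence at k = 1.\<close>

theorem theorem6:
  "quasi_uniform (\<lambda>n. octa_config (Suc n))
   \<and> (\<forall>k\<ge>3. mesh_ratio (octa_config k)
              \<le> 1 / 4 * sqrt ((4 + pi\<^sup>2) / (2 - (real k + 1)\<^sup>2 / (real k)\<^sup>2)))
   \<and> (\<lambda>k::nat. 1 / 4 * sqrt ((4 + pi\<^sup>2) / (2 - (real k + 1)\<^sup>2 / (real k)\<^sup>2)))
        \<longlonglongrightarrow> sqrt (4 + pi\<^sup>2) / 4
   \<and> \<bar>sqrt (4 + pi\<^sup>2) / 4 - 0.931048\<bar> \<le> 5 / 10 ^ 7"
  using quasi_uniform_octa_config mesh_ratio_octa_config_le bound_tendsto limit_numerics by blast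

end
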